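(* Let $m>2$ be an integer, let $N=m^3-1$ and $\mathbf{v}=(1,m,m^2)$. Then $$\lambda^{\ast}(\Pi_{N,\mathbf{v}})=\sqrt{1+m^2+m^4},$$ and consequently $$\lim_{m\to\infty}\frac{\lambda^{\ast}(\Pi_{N,\mathbf{v}})}{N^{2/3}}=1,$$ where $N=m^3-1$ depends on $m$.
   Context: For integers $N,a,b,c$ with $0<a<b<c<N$, write $\mathbf{v}=(a,b,c)$ and define $$\Pi_{N,\mathbf{v}}=\{(na \bmod N,\ nb \bmod N,\ nc \bmod N): 0\le n<N\},$$ where $x \bmod N$ denotes the least nonnegative residue of $x$ modulo $N$, and $$\lambda^{\ast}(\Pi_{N,\mathbf{v}})=\min_{\mathbf{x}\neq\mathbf{y},\ \mathbf{x},\mathbf{y}\in\Pi_{N,\mathbf{v}}}\|\mathbf{x}-\mathbf{y}\|$$ (Euclidean norm). *)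

theory Defs
  imports "HOL-Analysis.Analysis"
begin

text \<open>
  The intended parameters satisfy \<open>0 < a < b < c < N\<close>; the definitions themselves are total.
\<close>

fun point_set :: "nat \<Rightarrow> nat \<times> nat \<times> nat \<Rightarrow> (real ^ 3) set" where
  "point_set N (a, b, c) =
     {vector [real ((n * a) mod N), real ((n * b) mod N), real ((n * c) mod N)] | n. n < N}"

text \<open>
  For the intended parameters the set of distances below is finite and nonempty, so \<^const>\<open>Min\<close>
  is a genuine minimum; \<^const>\<open>norm\<close> on \<^typ>\<open>real ^ 3\<close> is the Euclidean norm.
\<close>

definition min_dist :: "(real ^ 3) set \<Rightarrow> real" where
  "min_dist P = Min {norm (x - y) | x y. x \<in> P \<and> y \<in> P \<and> x \<noteq> y}"

end

theory Submission
  imports Defs "HOL-Number_Theory.Cong" "HOL-Real_Asymp.Real_Asymp"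
begin

text \<open>
  The difference \<open>(x, y, z)\<close> of two points satisfies \<open>y = m x - N u\<close>, \<open>z = m y - N v\<close>, \<open>x = m z - N w\<close>
  for some integers \<open>u, v, w\<close>, where \<open>N = m\<^sup>3 - 1\<close>. Solving this cyclic system gives
  \<open>(x, y, z) = u (m\<^sup>2, 1, m) + v (m, m\<^sup>2, 1) + w (1, m, m\<^sup>2)\<close>. These three vectors
  have squared norm \<open>A = 1 + m\<^sup>2 + m\<^sup>4\<close> and pairwise inner product \<open>B = m + m\<^sup>2 + m\<^sup>3\<close>, so the squared
  norm of the combination is \<open>(u\<^sup>2 + v\<^sup>2 + w\<^sup>2) (A - B) + (u + v + w)\<^sup>2 B\<close>. For \<open>m > 2\<close> one has
  \<open>A \<ge> 2 B\<close>, and a nonzero combination has \<open>u + v + w \<noteq> 0\<close> or \<open>u\<^sup>2 + v\<^sup>2 + w\<^sup>2 \<ge> 2\<close>; either way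
  the value is at least \<open>A\<close>.
\<close>

lemma circulant_form_ge:
  fixes A B u v w :: int
  assumes "0 \<le> B" "2 * B \<le> A" "(u, v, w) \<noteq> (0, 0, 0)"
  shows "A \<le> (u\<^sup>2 + v\<^sup>2 + w\<^sup>2) * (A - B) + (u + v + w)\<^sup>2 * B"
proof (cases "u + v + w = 0")
  case True
  \<comment> \<open>A sum of squares has the parity of the plain sum, so here it is even and
    positive, hence at least 2; then \<open>2 * (A - B) = A + (A - 2 * B) \<ge> A\<close>.\<close>
  have "even (u + v + w)"
    using True by simp
  then have "even (u\<^sup>2 + v\<^sup>2 + w\<^sup>2)"
    by simp
  moreover have "u\<^sup>2 + v\<^sup>2 + w\<^sup>2 > 0"
    using assms(3) by (auto simp: add_pos_nonneg add_nonneg_pos)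
  ultimately have "2 \<le> u\<^sup>2 + v\<^sup>2 + w\<^sup>2"
    by (rule zdvd_imp_le)
  then have "2 * (A - B) \<le> (u\<^sup>2 + v\<^sup>2 + w\<^sup>2) * (A - B)"
    using assms by (intro mult_right_mono) auto
  then show ?thesis
    using True assms by simp
next
  case False
  have "u\<^sup>2 + v\<^sup>2 + w\<^sup>2 > 0"
    using assms(3) by (auto simp: add_pos_nonneg add_nonneg_pos)
  then have "1 * (A - B) \<le> (u\<^sup>2 + v\<^sup>2 + w\<^sup>2) * (A - B)"
    using assms by (intro mult_right_mono) auto
  moreover have "(u + v + w)\<^sup>2 > 0"
    using False by simp
  then have "1 \<le> (u + v + w)\<^sup>2"
    by linarith
  then have "1 * B \<le> (u + v + w)\<^sup>2 * B"
    using assms by (intro mult_right_mono) auto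
  ultimately show ?thesis
    by simp
qed

lemma cyclic_lattice_norm_ge:
  fixes m x y z :: int
  assumes m: "m > 2"
    and "[y = m * x] (mod (m ^ 3 - 1))" "[z = m * y] (mod (m ^ 3 - 1))"
      "[x = m * z] (mod (m ^ 3 - 1))"
    and nz: "(x, y, z) \<noteq> (0, 0, 0)"
  shows "1 + m\<^sup>2 + m ^ 4 \<le> x\<^sup>2 + y\<^sup>2 + z\<^sup>2"
proof -
  define N where "N = m ^ 3 - 1"
  have N: "N > 0"
    using m one_less_power[of m 3] by (simp add: N_def)
  obtain u v w where u: "m * x = y + N * u" and v: "m * y = z + N * v" and w: "m * z = x + N * w"
    using assms(2-4) unfolding N_def cong_iff_lin by blast
  \<comment> \<open>Going once around the cycle expresses \<open>m ^ 3 * x\<close> as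
    \<open>x\<close> plus a multiple of \<open>N\<close>; subtracting \<open>x\<close> leaves
    \<open>N * x\<close> on the left.\<close>
  have "N * x = N * (m\<^sup>2 * u + m * v + w)"
    using u v w unfolding N_def by algebra
  then have x: "x = m\<^sup>2 * u + m * v + w"
    using N by simp
  have "N * y = N * (m\<^sup>2 * v + m * w + u)"
    using u v w unfolding N_def by algebra
  then have y: "y = m\<^sup>2 * v + m * w + u"
    using N by simp
  have "N * z = N * (m\<^sup>2 * w + m * u + v)"
    using u v w unfolding N_def by algebra
  then have z: "z = m\<^sup>2 * w + m * u + v"
    using N by simp
  define A B where "A = 1 + m\<^sup>2 + m ^ 4" and "B = m + m\<^sup>2 + m ^ 3"
  \<comment> \<open>This is where \<open>m \<ge> 3\<close> matters: for \<open>m = 2\<close> one has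
    \<open>A = 21\<close> and \<open>B = 14\<close>.\<close>
  have AB: "2 * B \<le> A"
  proof -
    have "0 \<le> (m - 3) * m ^ 3" "0 \<le> (m - 3) * m\<^sup>2" "0 \<le> (m - 3) * m"
      using m by simp_all
    then have "3 * m ^ 3 \<le> m ^ 4" "3 * m\<^sup>2 \<le> m ^ 3" "3 * m \<le> m\<^sup>2"
      by (simp_all add: left_diff_distrib eval_nat_numeral)
    then show ?thesis
      using m by (simp add: A_def B_def)
  qed
  have "0 \<le> B"
    using m by (simp add: B_def)
  moreover have "(u, v, w) \<noteq> (0, 0, 0)"
    using nz x y z by auto
  ultimately have "A \<le> (u\<^sup>2 + v\<^sup>2 + w\<^sup>2) * (A - B) + (u + v + w)\<^sup>2 * B"
    using AB circulant_form_ge by blast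
  \<comment> \<open>Expanding the squares gives \<open>A\<close> times the sum of squares plus
    \<open>2 * B * (u * v + v * w + w * u)\<close>.\<close>
  also have "\<dots> = x\<^sup>2 + y\<^sup>2 + z\<^sup>2"
    unfolding x y z A_def B_def by algebra
  finally show ?thesis
    by (simp add: A_def)
qed

lemma norm_vector_3: "norm (vector [a, b, c] :: real ^ 3) = sqrt (a\<^sup>2 + b\<^sup>2 + c\<^sup>2)"
  by (simp add: norm_vec_def L2_set_def sum_3)

text \<open>Reduction modulo \<open>N\<close> preserves congruences, so the coordinate differences
  are congruent to \<open>k - l\<close> times 1, \<open>m\<close>, \<open>m ^ 2\<close> and satisfy
  the cyclic system.\<close>

lemma point_set_diff_norm_ge:
  fixes m :: nat
  assumes m: "m > 2"
    and "p \<in> point_set (m ^ 3 - 1) (1, m, m\<^sup>2)" "q \<in> point_set (m ^ 3 - 1) (1, m, m\<^sup>2)"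
    and "p \<noteq> q"
  shows "sqrt (1 + real m ^ 2 + real m ^ 4) \<le> norm (p - q)"
proof -
  define N where "N = m ^ 3 - 1"
  have N: "int N = int m ^ 3 - 1"
    using m by (simp add: N_def of_nat_diff)
  obtain k l where
    p: "p = vector [real ((k * 1) mod N), real ((k * m) mod N), real ((k * m\<^sup>2) mod N)]" and
    q: "q = vector [real ((l * 1) mod N), real ((l * m) mod N), real ((l * m\<^sup>2) mod N)]"
    using assms(2,3) by (auto simp: N_def)
  define d where "d c = int ((k * c) mod N) - int ((l * c) mod N)" for c
  have d: "[d c = (int k - int l) * int c] (mod int N)" for c
    unfolding d_def by (simp add: cong_def zmod_int mod_diff_eq left_diff_distrib)
  have 1: "[d m = int m * d 1] (mod int N)"
  proof -
    have "[int m * d 1 = int m * ((int k - int l) * int 1)] (mod int N)"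
      by (intro cong_mult cong_refl d)
    also have "int m * ((int k - int l) * int 1) = (int k - int l) * int m"
      by simp
    finally show ?thesis
      using d cong_trans cong_sym by blast
  qed
  have 2: "[d (m\<^sup>2) = int m * d m] (mod int N)"
  proof -
    have "[int m * d m = int m * ((int k - int l) * int m)] (mod int N)"
      by (intro cong_mult cong_refl d)
    also have "int m * ((int k - int l) * int m) = (int k - int l) * int (m\<^sup>2)"
      by (simp add: power2_eq_square)
    finally show ?thesis
      using d cong_trans cong_sym by blast
  qed
  have 3: "[d 1 = int m * d (m\<^sup>2)] (mod int N)"
  proof -
    have "[int m * d (m\<^sup>2) = int m * ((int k - int l) * int (m\<^sup>2))] (mod int N)"
      by (intro cong_mult cong_refl d)
    \<comment> \<open>The cycle closes because \<open>m ^ 3 = N + 1\<close>.\<close>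
    also have "int m * ((int k - int l) * int (m\<^sup>2)) = (int k - int l) * int 1 + int N * (int k - int l)"
      unfolding N by (simp add: power2_eq_square power3_eq_cube algebra_simps)
    also have "[\<dots> = (int k - int l) * int 1] (mod int N)"
      by (simp add: cong_def)
    finally show ?thesis
      using d cong_trans cong_sym by blast
  qed
  have pq: "p - q = vector [real_of_int (d 1), real_of_int (d m), real_of_int (d (m\<^sup>2))]"
    unfolding p q d_def by (simp add: vec_eq_iff forall_3)
  have "(d 1, d m, d (m\<^sup>2)) \<noteq> (0, 0, 0)"
  proof
    assume "(d 1, d m, d (m\<^sup>2)) = (0, 0, 0)"
    then have "p - q = 0"
      unfolding pq by (simp add: vec_eq_iff forall_3)
    then show False
      using assms(4) by simp
  qed
  then have "1 + (int m)\<^sup>2 + int m ^ 4 \<le> (d 1)\<^sup>2 + (d m)\<^sup>2 + (d (m\<^sup>2))\<^sup>2"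
    using m 1 2 3 unfolding N by (intro cyclic_lattice_norm_ge) auto
  then have "real_of_int (1 + (int m)\<^sup>2 + int m ^ 4) \<le> real_of_int ((d 1)\<^sup>2 + (d m)\<^sup>2 + (d (m\<^sup>2))\<^sup>2)"
    by (simp only: of_int_le_iff)
  then show ?thesis
    unfolding pq norm_vector_3 by simp
qed

lemma finite_point_set: "finite (point_set N v)"
  by (cases v) simp

lemma min_dist_point_set_powers:
  fixes m :: nat
  assumes m: "m > 2"
  shows "min_dist (point_set (m ^ 3 - 1) (1, m, m ^ 2)) = sqrt (1 + real m ^ 2 + real m ^ 4)"
proof -
  define P where "P = point_set (m ^ 3 - 1) (1, m, m ^ 2)"
  let ?D = "{norm (x - y) | x y. x \<in> P \<and> y \<in> P \<and> x \<noteq> y}"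
  have "?D \<subseteq> (\<lambda>(x, y). norm (x - y)) ` (P \<times> P)"
    by auto
  then have fin: "finite ?D"
    by (rule finite_subset) (simp add: P_def finite_point_set)
  \<comment> \<open>These bounds ensure that 1, \<open>m\<close> and \<open>m ^ 2\<close> are their
    own residues modulo \<open>m ^ 3 - 1\<close>.\<close>
  have "3 * m\<^sup>2 \<le> m ^ 3"
    using m by (simp add: power2_eq_square power3_eq_cube)
  moreover have "m < m\<^sup>2"
    using m by (simp add: power2_eq_square)
  ultimately have lt: "m\<^sup>2 < m ^ 3 - 1" "m < m ^ 3 - 1" "1 < m ^ 3 - 1"
    using m by linarith+
  \<comment> \<open>The minimum is attained between the origin and \<open>e\<close>, the points with
    indices 0 and 1.\<close>
  define e where "e = (vector [1, real m, real m ^ 2] :: real ^ 3)"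
  have "0 \<in> P"
    unfolding P_def point_set.simps
    using lt by (intro CollectI exI[of _ 0]) (simp add: vec_eq_iff forall_3)
  moreover have "e \<in> P"
    unfolding P_def point_set.simps e_def
    using lt by (intro CollectI exI[of _ 1]) simp
  moreover have "e \<noteq> 0"
    by (simp add: e_def vec_eq_iff forall_3)
  moreover have "norm (e - 0) = sqrt (1 + real m ^ 2 + real m ^ 4)"
    by (simp add: e_def norm_vector_3 flip: power_mult)
  ultimately have "sqrt (1 + real m ^ 2 + real m ^ 4) \<in> ?D"
    by (metis (mono_tags, lifting) mem_Collect_eq)
  then show ?thesis
    unfolding min_dist_def P_def[symmetric]
    using fin point_set_diff_norm_ge[OF m] by (intro Min_eqI) (auto simp: P_def)
qed

theorem theorem2:
  shows "(\<forall>m::nat. m > 2 \<longrightarrow>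
            min_dist (point_set (m ^ 3 - 1) (1, m, m ^ 2)) = sqrt (1 + real m ^ 2 + real m ^ 4))
         \<and> ((\<lambda>m::nat. min_dist (point_set (m ^ 3 - 1) (1, m, m ^ 2)) / real (m ^ 3 - 1) powr (2 / 3))
              \<longlonglongrightarrow> 1)"
proof (intro conjI allI impI)
  \<comment> \<open>Numerator and denominator both grow like \<open>m ^ 2\<close>. The subtraction
    is taken in the reals here; it agrees with the natural one for \<open>m > 2\<close>.\<close>
  have "(\<lambda>m::nat. sqrt (1 + real m ^ 2 + real m ^ 4) / (real m ^ 3 - 1) powr (2 / 3)) \<longlonglongrightarrow> 1"
    by real_asymp
  moreover have "\<forall>\<^sub>F m::nat in sequentially.
      sqrt (1 + real m ^ 2 + real m ^ 4) / (real m ^ 3 - 1) powr (2 / 3) =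
      min_dist (point_set (m ^ 3 - 1) (1, m, m ^ 2)) / real (m ^ 3 - 1) powr (2 / 3)"
    using eventually_gt_at_top[of 2]
  proof eventually_elim
    case (elim m)
    have "real (m ^ 3 - 1) = real m ^ 3 - 1"
      using elim by (simp add: of_nat_diff)
    then show ?case
      by (simp only: min_dist_point_set_powers[OF elim])
  qed
  ultimately show "(\<lambda>m::nat. min_dist (point_set (m ^ 3 - 1) (1, m, m ^ 2)) /
      real (m ^ 3 - 1) powr (2 / 3)) \<longlonglongrightarrow> 1"
    by (rule Lim_transform_eventually)
qed (rule min_dist_point_set_powers)

end
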